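(* Let $G=(V,E)$ be a graph and let $J$ be a set of subsets of $V$. Then $z^{\mathcal{S}}_{J}(G)=z^{\mathcal{C}}_{J}(G)$. In particular, $z^{\mathcal{S}}_{k}(G)=z^{\mathcal{C}}_{k}(G)$ for every integer $k$ with $0\leqslant k\leqslant |V|$.
   Context: Graphs are finite, simple and undirected, with vertex set $V=\{1,\dots,n\}$, $n\geqslant 1$. $\mathcal{S}_n$ denotes the set of real symmetric $n\times n$ matrices, $\mathbf{1}_{n\times n}$ the all-ones matrix, $\langle X,Y\rangle=\sum_{i,j}X_{i,j}Y_{i,j}$, and $X\succcurlyeq 0$ means positive semidefinite. For a graph $H$, the set of stable set vectors is $\mathcal{S}(H)=\{s\in\{0,1\}^{V(H)} : s_is_j=0 \text{ for all } \{i,j\}\in E(H)\}$. The squared stable set polytope is $\operatorname{STAB}^2(H)=\operatorname{conv}\{ss^T : s\in\mathcal{S}(H)\}$, and the scaled squared stable set polytope is $$\operatorname{SSTAB}^2(H)=\operatorname{conv}\left(\left\{\tfrac{1}{s^Ts}ss^T : s\in\mathcal{S}(H),\ s\neq 0\right\}\cup\{0\}\right),$$ where the last $0$ is the zero matrix. For $I\subseteq V$, $G_I$ is the subgraph of $G$ induced by $I$, and for an $n\times n$ matrix $X$, $X_I=(X_{i,j})_{i,j\in I}$. For $I=\emptyset$ the constraints $X_I\in\operatorname{STAB}^2(G_I)$ and $X_I\in\operatorname{SSTAB}^2(G_I)$ are vacuous. Define $$\operatorname{CTH}^2(G)=\{X\in\mathcal{S}_n : \operatorname{trace}(X)=1,\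 X_{i,j}=0\ \forall\{i,j\}\in E,\ X\succcurlyeq 0\}.$$ For a set $J$ of subsets of $V$ define $$z^{\mathcal{C}}_{J}(G)=\max\{\langle\mathbf{1}_{n\times n},X\rangle : X\in\operatorname{CTH}^2(G),\ X_I\in\operatorname{STAB}^2(G_I)\ \forall I\in J\},$$ $$z^{\mathcal{S}}_{J}(G)=\max\{\langle\mathbf{1}_{n\times n},X\rangle : X\in\operatorname{CTH}^2(G),\ X_I\in\operatorname{SSTAB}^2(G_I)\ \forall I\in J\}.$$ For an integer $0\leqslant k\leqslant n$ let $J_k=\{I\subseteq V : |I|=k\}$, and set $z^{\mathcal{C}}_{k}(G)=z^{\mathcal{C}}_{J_k}(G)$ and $z^{\mathcal{S}}_{k}(G)=z^{\mathcal{S}}_{J_k}(G)$ (the $k$-th levels of the compressed and the scaled exact subgraph hierarchy). *)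

theory Defs
  imports "HOL-Analysis.Analysis"
begin

record 'a sgraph =
  verts :: "'a set"
  edges :: "'a set set"

definition simple_graph :: "'a sgraph \<Rightarrow> bool" where
  "simple_graph G \<longleftrightarrow> finite (verts G) \<and> (\<forall>e\<in>edges G. e \<subseteq> verts G \<and> card e = 2)"

definition induced_subgraph :: "'a sgraph \<Rightarrow> 'a set \<Rightarrow> 'a sgraph" where
  "induced_subgraph G I = \<lparr>verts = I, edges = {e \<in> edges G. e \<subseteq> I}\<rparr>"

text \<open>
  A graph under study has all elements of a finite type \<open>'n\<close> as its vertices. The vertex set
  of an induced subgraph is a subset \<open>I\<close> of \<open>'n\<close>. Vectors and matrices indexed by \<open>I\<close> are
  represented in \<open>real ^ 'n\<close> and \<open>real ^ 'n ^ 'n\<close> with all entries outside \<open>I\<close> equal to \<open>0\<close>.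
  This is an injective linear embedding, so it commutes with convex hulls and it preserves
  inner products. For \<open>I = {}\<close> both polytopes below are \<open>{0}\<close> and the submatrix of every
  matrix is \<open>0\<close>, so that the corresponding constraints hold vacuously.
\<close>

definition submatrix_on :: "real ^ 'n ^ 'n \<Rightarrow> 'n set \<Rightarrow> real ^ 'n ^ 'n" where
  "submatrix_on X I = (\<chi> i j. if i \<in> I \<and> j \<in> I then X $ i $ j else 0)"

definition stable_set_vectors :: "'n::finite sgraph \<Rightarrow> (real ^ 'n) set" where
  "stable_set_vectors H =
     {s. (\<forall>i\<in>verts H. s $ i \<in> {0, 1}) \<and> (\<forall>i. i \<notin> verts H \<longrightarrow> s $ i = 0) \<and>
         (\<forall>i j. {i, j} \<in> edges H \<longrightarrow> s $ i * s $ j = 0)}"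

definition outer_square :: "real ^ 'n \<Rightarrow> real ^ 'n ^ 'n" where
  "outer_square s = (\<chi> i j. s $ i * s $ j)"

definition STAB2 :: "'n::finite sgraph \<Rightarrow> (real ^ 'n ^ 'n) set" where
  "STAB2 H = convex hull {outer_square s | s. s \<in> stable_set_vectors H}"

definition SSTAB2 :: "'n::finite sgraph \<Rightarrow> (real ^ 'n ^ 'n) set" where
  "SSTAB2 H = convex hull
     ({(1 / (s \<bullet> s)) *\<^sub>R outer_square s | s. s \<in> stable_set_vectors H \<and> s \<noteq> 0} \<union> {0})"

definition pos_semidef :: "real ^ 'n ^ 'n \<Rightarrow> bool" where
  "pos_semidef X \<longleftrightarrow> (\<forall>v. v \<bullet> (X *v v) \<ge> 0)"

definition CTH2 :: "'n::finite sgraph \<Rightarrow> (real ^ 'n ^ 'n) set" where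
  "CTH2 G = {X. transpose X = X \<and> trace X = 1 \<and>
               (\<forall>i j. {i, j} \<in> edges G \<longrightarrow> X $ i $ j = 0) \<and> pos_semidef X}"

definition all_ones :: "real ^ 'n ^ 'n" where
  "all_ones = (\<chi> i j. 1)"

definition feasible_C :: "'n::finite set set \<Rightarrow> 'n sgraph \<Rightarrow> (real ^ 'n ^ 'n) set" where
  "feasible_C J G = {X \<in> CTH2 G. \<forall>I\<in>J. submatrix_on X I \<in> STAB2 (induced_subgraph G I)}"

definition feasible_S :: "'n::finite set set \<Rightarrow> 'n sgraph \<Rightarrow> (real ^ 'n ^ 'n) set" where
  "feasible_S J G = {X \<in> CTH2 G. \<forall>I\<in>J. submatrix_on X I \<in> SSTAB2 (induced_subgraph G I)}"

text \<open>
  The inner product of \<open>real ^ 'n ^ 'n\<close> is the sum of all products of corresponding entries.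
  The operator \<open>GREATEST\<close> is only meaningful if the maximum is attained, which the lemmas
  \<open>max_attained_C\<close> and \<open>max_attained_S\<close> below establish.
\<close>

definition z_C :: "'n::finite set set \<Rightarrow> 'n sgraph \<Rightarrow> real" where
  "z_C J G = (GREATEST z. \<exists>X\<in>feasible_C J G. z = all_ones \<bullet> X)"

definition z_S :: "'n::finite set set \<Rightarrow> 'n sgraph \<Rightarrow> real" where
  "z_S J G = (GREATEST z. \<exists>X\<in>feasible_S J G. z = all_ones \<bullet> X)"

definition subsets_of_size :: "nat \<Rightarrow> 'n sgraph \<Rightarrow> 'n set set" where
  "subsets_of_size k G = {I. I \<subseteq> verts G \<and> card I = k}"

definition level_C :: "nat \<Rightarrow> 'n::finite sgraph \<Rightarrow> real" where
  "level_C k G = z_C (subsets_of_size k G) G"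

definition level_S :: "nat \<Rightarrow> 'n::finite sgraph \<Rightarrow> real" where
  "level_S k G = z_S (subsets_of_size k G) G"


lemma finite_stable_set_vectors: "finite (stable_set_vectors (H :: 'n::finite sgraph))"
proof (rule finite_subset)
  show "stable_set_vectors H \<subseteq> range (\<lambda>A. \<chi> i. if i \<in> A then 1 else 0)"
  proof
    fix s assume s: "s \<in> stable_set_vectors H"
    then have "s = (\<chi> i. if i \<in> {i. s $ i = 1} then 1 else 0)"
      by (auto simp: stable_set_vectors_def vec_eq_iff)
    then show "s \<in> range (\<lambda>A. \<chi> i. if i \<in> A then 1 else 0)" by blast
  qed
qed simp

lemma compact_STAB2: "compact (STAB2 H)"
  unfolding STAB2_def Setcompr_eq_image
  by (intro finite_imp_compact_convex_hull finite_imageI) (simp add: finite_stable_set_vectors)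

lemma compact_SSTAB2: "compact (SSTAB2 H)"
proof -
  have "finite {(1 / (s \<bullet> s)) *\<^sub>R outer_square s | s. s \<in> stable_set_vectors H \<and> s \<noteq> 0}"
    by (rule finite_subset[of _ "(\<lambda>s. (1 / (s \<bullet> s)) *\<^sub>R outer_square s) ` stable_set_vectors H"])
      (auto simp: finite_stable_set_vectors)
  then show ?thesis
    unfolding SSTAB2_def by (intro finite_imp_compact_convex_hull) simp
qed

lemma continuous_submatrix_on:
  "continuous_on UNIV (\<lambda>X :: real ^ 'n ^ 'n. submatrix_on X I)"
proof -
  have "continuous_on UNIV (\<lambda>X :: real ^ 'n ^ 'n. if i \<in> I \<and> j \<in> I then X $ i $ j else 0)" for i j
    by (cases "i \<in> I \<and> j \<in> I") (auto intro!: continuous_intros)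
  then show ?thesis
    unfolding submatrix_on_def by (intro continuous_on_vec_lambda)
qed

lemma CTH2_entry_bound:
  assumes "X \<in> CTH2 G" shows "\<bar>X $ i $ j\<bar> \<le> 1"
proof -
  have tr: "(\<Sum>i\<in>UNIV. X $ i $ i) = 1" and sym: "X $ j $ i = X $ i $ j"
    and psd: "\<And>v. v \<bullet> (X *v v) \<ge> 0"
    using assms by (auto simp: CTH2_def trace_def pos_semidef_def transpose_def vec_eq_iff)
  have ax: "axis k a \<bullet> (X *v axis l b) = a * b * X $ k $ l" for k l a b
    unfolding inner_axis'
    by (simp add: matrix_vector_mult_def axis_def if_distrib[of "(*) _"] cong: if_cong)
  have q: "(axis k a + axis l b) \<bullet> (X *v (axis k a + axis l b)) =
     a * a * X $ k $ k + a * b * X $ k $ l + b * a * X $ l $ k + b * b * X $ l $ l" for k l a b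
    unfolding matrix_vector_right_distrib inner_add_left inner_add_right ax by simp
  have d0: "X $ k $ k \<ge> 0" for k
    using psd[of "axis k 1 + axis k 0"] unfolding q by simp
  have d1: "X $ k $ k \<le> 1" for k
    using member_le_sum[of k UNIV "\<lambda>i. X $ i $ i"] d0 tr by simp
  show ?thesis
    using psd[of "axis i 1 + axis j 1"] psd[of "axis i 1 + axis j (-1)"] d1[of i] d1[of j]
    unfolding q sym by simp
qed

lemma compact_CTH2: "compact (CTH2 G)"
proof -
  have "bounded (CTH2 G)"
  proof (rule boundedI)
    fix X assume X: "X \<in> CTH2 G"
    have "norm X \<le> (\<Sum>i\<in>UNIV. norm (X $ i))"
      unfolding norm_vec_def[of X] by (rule L2_set_le_sum) simp
    also have "\<dots> \<le> (\<Sum>i\<in>UNIV. \<Sum>j\<in>UNIV. \<bar>X $ i $ j\<bar>)" by (intro sum_mono norm_le_l1_cart)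
    also have "\<dots> \<le> (\<Sum>i\<in>(UNIV::'a set). \<Sum>j\<in>(UNIV::'a set). 1)"
      by (intro sum_mono CTH2_entry_bound[OF X])
    finally show "norm X \<le> (\<Sum>i\<in>(UNIV::'a set). \<Sum>j\<in>(UNIV::'a set). 1)" .
  qed
  moreover have "closed (CTH2 G)"
  proof -
    have "CTH2 G = {X. \<forall>i j. X $ i $ j = X $ j $ i} \<inter> {X. (\<Sum>i\<in>UNIV. X $ i $ i) = 1} \<inter>
      {X. \<forall>i j. {i, j} \<in> edges G \<longrightarrow> X $ i $ j = 0} \<inter>
      {X. \<forall>v. (\<Sum>i\<in>UNIV. v $ i * (\<Sum>j\<in>UNIV. X $ i $ j * v $ j)) \<ge> 0}"
      by (auto simp: CTH2_def trace_def pos_semidef_def transpose_def vec_eq_iff inner_vec_def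
          matrix_vector_mult_def)
    also have "closed \<dots>"
      by (intro closed_Int closed_Collect_all closed_Collect_imp closed_Collect_eq
          closed_Collect_le open_Collect_const continuous_intros)
    finally show ?thesis .
  qed
  ultimately show ?thesis by (simp add: compact_eq_bounded_closed)
qed

lemma unit_feasible:
  fixes G :: "'n::finite sgraph"
  assumes "simple_graph G"
  shows "\<exists>X. X \<in> feasible_C J G \<inter> feasible_S J G"
proof -
  obtain a :: 'n where True by simp
  define e where "e = (axis a 1 :: real ^ 'n)"
  have noloop: "{a} \<notin> edges G"
    using assms by (auto simp: simple_graph_def)
  have e: "e $ i = (if i = a then 1 else 0)" for i by (simp add: e_def axis_def)
  have edge: "outer_square e $ i $ j = 0" if "{i, j} \<in> edges G" for i j
    using that noloop by (auto simp: outer_square_def e)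
  have "v \<bullet> (outer_square e *v v) = (e \<bullet> v) * (e \<bullet> v)" for v
    by (simp add: outer_square_def inner_vec_def matrix_vector_mult_def sum_product
        sum_distrib_left mult_ac)
  then have "pos_semidef (outer_square e)"
    by (simp add: pos_semidef_def)
  moreover have "trace (outer_square e) = 1"
    by (simp add: outer_square_def trace_def e if_distrib[of "(*) _"] cong: if_cong)
  moreover have "transpose (outer_square e) = outer_square e"
    by (simp add: outer_square_def transpose_def mult.commute)
  ultimately have "outer_square e \<in> CTH2 G"
    using edge by (simp add: CTH2_def)
  moreover have "submatrix_on (outer_square e) I \<in> STAB2 (induced_subgraph G I)
      \<and> submatrix_on (outer_square e) I \<in> SSTAB2 (induced_subgraph G I)" for I
  proof (cases "a \<in> I")
    case True
    have s: "e \<in> stable_set_vectors (induced_subgraph G I)"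
      using True noloop by (auto simp: stable_set_vectors_def induced_subgraph_def e)
    have eq: "submatrix_on (outer_square e) I = outer_square e"
      using True by (auto simp: submatrix_on_def outer_square_def vec_eq_iff e)
    have "e \<noteq> 0" "e \<bullet> e = 1" by (auto simp: e_def inner_axis axis_eq_0_iff)
    then have "outer_square e = (1 / (e \<bullet> e)) *\<^sub>R outer_square e" "e \<noteq> 0" by simp_all
    with s show ?thesis unfolding eq STAB2_def SSTAB2_def
      by (intro conjI hull_inc) blast+
  next
    case False
    have z: "submatrix_on (outer_square e) I = 0" "outer_square 0 = (0 :: real ^ 'n ^ 'n)"
      using False by (auto simp: submatrix_on_def outer_square_def vec_eq_iff e)
    have "0 \<in> stable_set_vectors (induced_subgraph G I)"
      by (auto simp: stable_set_vectors_def)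
    then have "(0 :: real ^ 'n ^ 'n) \<in> {outer_square s |s. s \<in> stable_set_vectors (induced_subgraph G I)}"
      using z(2) by (metis (mono_tags, lifting) mem_Collect_eq)
    then show ?thesis unfolding z STAB2_def SSTAB2_def by (intro conjI hull_inc) auto
  qed
  ultimately show ?thesis by (auto simp: feasible_C_def feasible_S_def)
qed

lemma max_attained_aux:
  fixes P :: "'n::finite set \<Rightarrow> (real ^ 'n ^ 'n) set"
  assumes "\<And>I. closed (P I)" and "{X \<in> CTH2 G. \<forall>I\<in>J. submatrix_on X I \<in> P I} \<noteq> {}"
  shows "\<exists>X\<in>{X \<in> CTH2 G. \<forall>I\<in>J. submatrix_on X I \<in> P I}.
    \<forall>Y\<in>{X \<in> CTH2 G. \<forall>I\<in>J. submatrix_on X I \<in> P I}. all_ones \<bullet> Y \<le> all_ones \<bullet> X"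
proof (rule continuous_attains_sup[OF _ assms(2)])
  have "closed (\<Inter>I\<in>J. (\<lambda>X. submatrix_on X I) -` P I)"
    using assms(1) by (intro closed_INT ballI) (auto intro: closed_vimage continuous_submatrix_on)
  moreover have "{X \<in> CTH2 G. \<forall>I\<in>J. submatrix_on X I \<in> P I} =
      CTH2 G \<inter> (\<Inter>I\<in>J. (\<lambda>X. submatrix_on X I) -` P I)" by auto
  ultimately show "compact {X \<in> CTH2 G. \<forall>I\<in>J. submatrix_on X I \<in> P I}"
    by (simp add: compact_Int_closed compact_CTH2)
qed (intro continuous_intros)

lemma max_attained_C:
  assumes "simple_graph G"
  shows "\<exists>X\<in>feasible_C J G. \<forall>Y\<in>feasible_C J G. all_ones \<bullet> Y \<le> all_ones \<bullet> X"
  using unit_feasible[OF assms, of J] unfolding feasible_C_def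
  by (intro max_attained_aux) (auto intro: compact_imp_closed compact_STAB2)

lemma max_attained_S:
  assumes "simple_graph G"
  shows "\<exists>X\<in>feasible_S J G. \<forall>Y\<in>feasible_S J G. all_ones \<bullet> Y \<le> all_ones \<bullet> X"
  using unit_feasible[OF assms, of J] unfolding feasible_S_def
  by (intro max_attained_aux) (auto intro: compact_imp_closed compact_SSTAB2)

end

theory Submission
  imports Defs
begin

text \<open>
  Not only do the two maxima agree, the two feasible sets are equal. Since the zero vector is a
  stable set vector, scaling \<open>s s\<^sup>T\<close> down by \<open>1 / s\<^sup>T s \<le> 1\<close> does not leave \<open>STAB2\<close>,
  so \<open>SSTAB2 \<subseteq> STAB2\<close> (\<open>SSTAB2_subset_STAB2\<close>). Conversely, a convex combination
  \<open>\<Sum> \<lambda>\<^sub>s s s\<^sup>T\<close> can be rewritten as \<open>\<Sum> (\<lambda>\<^sub>s s\<^sup>T s) (s s\<^sup>T / s\<^sup>T s)\<close>, whose weights add up to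
  its trace because \<open>trace (s s\<^sup>T) = s\<^sup>T s\<close>. If the trace is at most \<open>1\<close>, the missing weight
  can be put on the zero matrix, which gives a point of \<open>SSTAB2\<close> (\<open>STAB2_trace_le_1_imp_SSTAB2\<close>).
  The trace bound is automatic for the submatrices in question: a matrix in \<open>CTH2\<close> has trace
  \<open>1\<close> and, being positive semidefinite, no negative diagonal entry, so the trace of each of its
  principal submatrices is at most \<open>1\<close>.
\<close>

lemma zero_in_stable_set_vectors: "0 \<in> stable_set_vectors H"
  by (simp add: stable_set_vectors_def)

lemma outer_square_0 [simp]: "outer_square 0 = 0"
  by (simp add: outer_square_def vec_eq_iff)

lemma trace_outer_square: "trace (outer_square s) = s \<bullet> s"
  by (simp add: trace_def outer_square_def inner_vec_def)

lemma trace_scaleR: "trace (c *\<^sub>R A) = c * trace (A :: real ^ 'n ^ 'n)"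
  by (simp add: trace_def sum_distrib_left)

lemma trace_sum: "trace (\<Sum>a\<in>A. f a) = (\<Sum>a\<in>A. trace (f a :: real ^ 'n ^ 'n))"
  by (simp add: trace_def sum.swap[of _ A])

text \<open>
  Nonzero stable set vectors are integral, which is what makes the scaling factor \<open>1 / (s \<bullet> s)\<close>
  a contraction.
\<close>

lemma stable_set_vector_inner_ge_1:
  assumes "s \<in> stable_set_vectors H" and "s \<noteq> 0"
  shows "s \<bullet> s \<ge> 1"
proof -
  obtain i where "s $ i \<noteq> 0"
    using assms(2) by (auto simp: vec_eq_iff)
  then have "s $ i = 1"
    using assms(1) by (auto simp: stable_set_vectors_def)
  then show ?thesis
    using member_le_sum[of i UNIV "\<lambda>i. s $ i * s $ i"] by (simp add: inner_vec_def)
qed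

lemma SSTAB2_subset_STAB2: "SSTAB2 H \<subseteq> STAB2 H"
proof -
  have conv: "convex (STAB2 H)"
    by (simp add: STAB2_def)
  have outer: "outer_square s \<in> STAB2 H" if "s \<in> stable_set_vectors H" for s
    using that by (auto simp: STAB2_def intro!: hull_inc)
  have zero: "0 \<in> STAB2 H"
    using outer[OF zero_in_stable_set_vectors] by simp
  have "(1 / (s \<bullet> s)) *\<^sub>R outer_square s \<in> STAB2 H"
    if s: "s \<in> stable_set_vectors H" "s \<noteq> 0" for s
  proof -
    have "(1 / (s \<bullet> s)) *\<^sub>R outer_square s + (1 - 1 / (s \<bullet> s)) *\<^sub>R 0 \<in> STAB2 H"
      using stable_set_vector_inner_ge_1[OF s]
      by (intro convexD[OF conv outer[OF s(1)] zero]) (auto simp: divide_le_eq)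
    then show ?thesis by simp
  qed
  then show ?thesis
    unfolding SSTAB2_def using zero conv by (intro hull_minimal) auto
qed

text \<open>
  For \<open>Y = outer_square s\<close> the scaling factor \<open>1 / (s \<bullet> s)\<close> is the inverse of the trace of \<open>Y\<close>,
  so the whole argument can be carried out with the matrices \<open>Y\<close> instead of the vectors \<open>s\<close>.
\<close>

lemma STAB2_trace_le_1_imp_SSTAB2:
  assumes X: "X \<in> STAB2 H" and tr: "trace X \<le> 1"
  shows "X \<in> SSTAB2 H"
proof -
  define S where "S = outer_square ` stable_set_vectors H"
  have fin: "finite S"
    by (simp add: S_def finite_stable_set_vectors)
  have zS: "0 \<in> S"
    unfolding S_def using zero_in_stable_set_vectors outer_square_0 by (metis image_eqI)
  obtain u where u0: "\<And>Y. Y \<in> S \<Longrightarrow> 0 \<le> u Y" and X_eq: "X = (\<Sum>Y\<in>S. u Y *\<^sub>R Y)"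
    using X unfolding STAB2_def Setcompr_eq_image S_def[symmetric] convex_hull_finite[OF fin]
    by auto
  have trS: "trace Y > 0" if "Y \<in> S" "Y \<noteq> 0" for Y
    using that by (auto simp: S_def trace_outer_square)
  \<comment> \<open>The zero matrix cannot be rescaled to trace \<open>1\<close>; it takes up the weight that the rescaled
    weights of the other matrices leave over.\<close>
  define w where "w Y = (if Y = 0 then 1 - trace X else u Y * trace Y)" for Y
  have "trace X = (\<Sum>Y\<in>S. u Y * trace Y)"
    by (simp add: X_eq trace_sum trace_scaleR)
  also have "\<dots> = (\<Sum>Y\<in>S - {0}. u Y * trace Y)"
    by (simp add: sum.remove[OF fin zS] trace_def)
  finally have sum_w: "sum w S = 1"
    by (simp add: sum.remove[OF fin zS] w_def)
  have w0: "w Y \<ge> 0" if "Y \<in> S" for Y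
    using that tr u0 trS by (simp add: w_def less_imp_le)
  have pt: "(1 / trace Y) *\<^sub>R Y \<in> SSTAB2 H" if Y: "Y \<in> S" for Y
  proof (cases "Y = 0")
    case True
    then show ?thesis by (simp add: SSTAB2_def hull_inc)
  next
    case False
    obtain s where s: "s \<in> stable_set_vectors H" "Y = outer_square s"
      using Y by (auto simp: S_def)
    with False have "s \<noteq> 0" by auto
    with s show ?thesis
      unfolding SSTAB2_def by (intro hull_inc) (auto simp: trace_outer_square)
  qed
  have "(\<Sum>Y\<in>S. w Y *\<^sub>R ((1 / trace Y) *\<^sub>R Y)) \<in> SSTAB2 H"
    by (intro convex_sum fin sum_w w0 pt) (simp add: SSTAB2_def)
  also have "(\<Sum>Y\<in>S. w Y *\<^sub>R ((1 / trace Y) *\<^sub>R Y)) = X"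
    unfolding X_eq using trS by (intro sum.cong) (force simp: w_def)+
  finally show ?thesis .
qed

lemma pos_semidef_diagonal_nonneg:
  assumes "pos_semidef (X :: real ^ 'n ^ 'n)"
  shows "X $ i $ i \<ge> 0"
proof -
  have "X $ i $ i = axis i 1 \<bullet> (X *v axis i 1)"
    by (simp add: inner_axis' matrix_vector_mult_basis column_def)
  then show ?thesis
    using assms by (simp add: pos_semidef_def)
qed

lemma trace_submatrix_on_le_trace:
  assumes "pos_semidef X"
  shows "trace (submatrix_on X I) \<le> trace X"
  using pos_semidef_diagonal_nonneg[OF assms]
  unfolding trace_def submatrix_on_def by (intro sum_mono) auto

lemma feasible_S_eq_feasible_C: "feasible_S J G = feasible_C J G"
proof -
  have "submatrix_on X I \<in> SSTAB2 H \<longleftrightarrow> submatrix_on X I \<in> STAB2 H" if "X \<in> CTH2 G" for X I H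
  proof -
    have "trace (submatrix_on X I) \<le> 1"
      using that trace_submatrix_on_le_trace[of X I] by (simp add: CTH2_def)
    then show ?thesis
      using SSTAB2_subset_STAB2 STAB2_trace_le_1_imp_SSTAB2 by blast
  qed
  then show ?thesis
    unfolding feasible_S_def feasible_C_def by blast
qed

theorem theorem2:
  fixes G :: "'n::finite sgraph" and J :: "'n set set"
  assumes "simple_graph G" and "verts G = UNIV" and "J \<subseteq> Pow (verts G)"
  shows "z_S J G = z_C J G \<and> (\<forall>k\<le>card (verts G). level_S k G = level_C k G)"
  by (simp add: level_S_def level_C_def z_S_def z_C_def feasible_S_eq_feasible_C)

end
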